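(* Let $\Pi^*\subseteq\Pi$ be the set of stationary points of $\rho$, i.e., policies $\pi\in\Pi$ with $(\pi'-\pi)^T\nabla\rho(\pi)\le0$ for all $\pi'\in\Pi$, and let $$c=\max_{\pi',\pi\in\Pi^*}\max_{s\in S}\frac{\lambda_{\pi'}(s)}{\lambda_\pi(s)},$$ assumed finite. Suppose that $\nabla\rho$ is Lipschitz continuous on $\Pi$ with constant $L$ and that the stepsize $\gamma_k=\alpha\in(0,1/L]$ is constant. Then the sequence $\pi_k$ generated by the projected policy gradient algorithm $$\pi_{k+1}=P_\Pi\big(\pi_k+\alpha\nabla\rho(\pi_k)\big),\qquad \pi_0\in\Pi,$$ has a limit point, and any limit point of the sequence $\pi_k$ is an optimal policy, i.e., maximizes $\rho$ over $\Pi$.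
   Context: Average reward dynamic programming. $S$ is a finite state space, $A$ a finite action set, $p(s,a,s')$ transition probabilities and $R:S\times A\times S\to\mathbb{R}$ a payoff function. A policy is $\pi=(\pi(s,a))_{s\in S,a\in A}$ with $\pi(s,\cdot)$ a probability measure on $A$ for each $s$; $\Pi\subseteq\mathbb{R}^{S\times A}$ is the (compact convex) set of all policies. A policy generates the Markov chain on $S$ with kernel $K_\pi(s,s')=\sum_{a\in A}\pi(s,a)p(s,a,s')$. Standing assumption: every policy is ergodic, i.e., $K_\pi$ is irreducible and aperiodic; $\lambda_\pi$ is its unique stationary distribution. The average reward of $\pi$ is $$\rho(\pi)=\lim_{T\to\infty}\frac1T\,\mathbb{E}_\pi\Big[\sum_{t=1}^T R(s(t),a(t),s(t+1))\Big]=\sum_{s\in S}\sum_{a\in A}\sum_{s'\in S}\lambda_\pi(s)\pi(s,a)p(s,a,s')R(s,a,s'),$$ independent of the initial state. $\rho$ is regarded as a differentiable function of the vector $(\pi(s,a))$ (tabular case, direct parameterization), extended differentiably to a neighbourhood of $\Pi$ in $\mathbb{R}^{S\times A}$, and $\nabla\rho(\pi)\in\mathbb{R}^{S\times A}$ is its gradient with respect to these coordinates. $P_X(x)=\operatorname{argmin}_{y\in X}\|y-x\|^2$ is Euclidean projection onto a closed convex set $X$. $\nabla\rho$ Lipschitz with constant $L>0$ means $\|\nabla\rho(x)-\nabla\rho(y)\|\le L\|x-y\|$ in the Euclidean norm. *)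

theory Defs
  imports "HOL-Probability.Probability"
begin

text \<open>
  States and actions are the elements of finite types \<open>'s\<close> and \<open>'a\<close>, and \<open>p s a\<close> is the law of
  the next state, so that \<open>p(s,a,s')\<close> is \<open>pmf (p s a) s'\<close>. A policy is a vector of
  \<open>real ^ ('s \<times> 'a)\<close>, whose norm is the Euclidean one.
\<close>

type_synonym ('s, 'a) policy = "real ^ ('s \<times> 'a)"

definition policies :: "('s::finite, 'a::finite) policy set" where
  "policies = {\<pi>. (\<forall>s a. 0 \<le> \<pi> $ (s, a)) \<and> (\<forall>s. (\<Sum>a\<in>UNIV. \<pi> $ (s, a)) = 1)}"

definition kernel ::
  "('s::finite \<Rightarrow> 'a::finite \<Rightarrow> 's pmf) \<Rightarrow> ('s, 'a) policy \<Rightarrow> 's \<Rightarrow> 's \<Rightarrow> real" where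
  "kernel p \<pi> s s' = (\<Sum>a\<in>UNIV. \<pi> $ (s, a) * pmf (p s a) s')"

primrec iterate_kernel :: "('s::finite \<Rightarrow> 's \<Rightarrow> real) \<Rightarrow> nat \<Rightarrow> 's \<Rightarrow> 's \<Rightarrow> real" where
  "iterate_kernel K 0 s s' = (if s = s' then 1 else 0)"
| "iterate_kernel K (Suc n) s s' = (\<Sum>u\<in>UNIV. K s u * iterate_kernel K n u s')"

definition irreducible_kernel :: "('s::finite \<Rightarrow> 's \<Rightarrow> real) \<Rightarrow> bool" where
  "irreducible_kernel K \<longleftrightarrow> (\<forall>s s'. \<exists>n. iterate_kernel K n s s' > 0)"

definition aperiodic_kernel :: "('s::finite \<Rightarrow> 's \<Rightarrow> real) \<Rightarrow> bool" where
  "aperiodic_kernel K \<longleftrightarrow> (\<forall>s. Gcd {n. n > 0 \<and> iterate_kernel K n s s > 0} = 1)"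

definition ergodic_policy ::
  "('s::finite \<Rightarrow> 'a::finite \<Rightarrow> 's pmf) \<Rightarrow> ('s, 'a) policy \<Rightarrow> bool" where
  "ergodic_policy p \<pi> \<longleftrightarrow> irreducible_kernel (kernel p \<pi>) \<and> aperiodic_kernel (kernel p \<pi>)"

definition stationary_distribution ::
  "('s::finite \<Rightarrow> 'a::finite \<Rightarrow> 's pmf) \<Rightarrow> ('s, 'a) policy \<Rightarrow> 's pmf" where
  "stationary_distribution p \<pi> =
     (THE \<mu>. \<forall>s'. pmf \<mu> s' = (\<Sum>s\<in>UNIV. pmf \<mu> s * kernel p \<pi> s s'))"

text \<open>Meaningful for \<open>\<pi> \<in> policies\<close>, where \<open>\<lambda>a. \<pi> $ (s, a)\<close> is a probability mass function.\<close>

definition action_pmf :: "('s::finite, 'a::finite) policy \<Rightarrow> 's \<Rightarrow> 'a pmf" where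
  "action_pmf \<pi> s = embed_pmf (\<lambda>a. \<pi> $ (s, a))"

text \<open>The law of \<open>[(s(1),a(1),s(2)), \<dots>, (s(T),a(T),s(T+1))]\<close> under \<open>\<pi>\<close> given the initial
  state \<open>s(1) = s\<close>.\<close>

primrec trajectory ::
  "('s::finite \<Rightarrow> 'a::finite \<Rightarrow> 's pmf) \<Rightarrow> ('s, 'a) policy \<Rightarrow> nat \<Rightarrow> 's \<Rightarrow> ('s \<times> 'a \<times> 's) list pmf"
where
  "trajectory p \<pi> 0 s = return_pmf []"
| "trajectory p \<pi> (Suc T) s =
     bind_pmf (action_pmf \<pi> s) (\<lambda>a. bind_pmf (p s a) (\<lambda>s'.
       map_pmf (\<lambda>h. (s, a, s') # h) (trajectory p \<pi> T s')))"

definition expected_total_reward ::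
  "('s::finite \<Rightarrow> 'a::finite \<Rightarrow> 's pmf) \<Rightarrow> ('s \<Rightarrow> 'a \<Rightarrow> 's \<Rightarrow> real) \<Rightarrow> ('s, 'a) policy \<Rightarrow> nat \<Rightarrow> 's \<Rightarrow> real"
where
  "expected_total_reward p R \<pi> T s =
     measure_pmf.expectation (trajectory p \<pi> T s) (\<lambda>h. \<Sum>(u, a, u')\<leftarrow>h. R u a u')"

text \<open>The common value, over all initial states, of the limiting average reward.\<close>

definition average_reward ::
  "('s::finite \<Rightarrow> 'a::finite \<Rightarrow> 's pmf) \<Rightarrow> ('s \<Rightarrow> 'a \<Rightarrow> 's \<Rightarrow> real) \<Rightarrow> ('s, 'a) policy \<Rightarrow> real"
where
  "average_reward p R \<pi> =
     (THE r. \<forall>s. (\<lambda>T. expected_total_reward p R \<pi> T s / real T) \<longlonglongrightarrow> r)"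

text \<open>
  \<open>policies\<close> has empty interior, so the gradient of the average reward is that of a differentiable
  extension \<open>f\<close> to an open neighbourhood \<open>U\<close>; \<open>G\<close> is the gradient field of such an extension.
\<close>

definition is_policy_gradient ::
  "('s::finite \<Rightarrow> 'a::finite \<Rightarrow> 's pmf) \<Rightarrow> ('s \<Rightarrow> 'a \<Rightarrow> 's \<Rightarrow> real) \<Rightarrow>
   (('s, 'a) policy \<Rightarrow> ('s, 'a) policy) \<Rightarrow> bool"
where
  "is_policy_gradient p R G \<longleftrightarrow>
     (\<exists>U f. open U \<and> policies \<subseteq> U \<and> (\<forall>\<pi>\<in>policies. f \<pi> = average_reward p R \<pi>) \<and>
            (\<forall>x\<in>U. GDERIV f x :> G x))"

definition stationary_policies ::
  "(('s::finite, 'a::finite) policy \<Rightarrow> ('s, 'a) policy) \<Rightarrow> ('s, 'a) policy set" where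
  "stationary_policies G = {\<pi>\<in>policies. \<forall>\<pi>'\<in>policies. (\<pi>' - \<pi>) \<bullet> G \<pi> \<le> 0}"

text \<open>Taken in the extended reals, where \<open>x / 0 = \<infinity>\<close> for \<open>x > 0\<close>, so that finiteness of the
  value is a genuine condition.\<close>

definition mismatch_coefficient ::
  "('s::finite \<Rightarrow> 'a::finite \<Rightarrow> 's pmf) \<Rightarrow> (('s, 'a) policy \<Rightarrow> ('s, 'a) policy) \<Rightarrow> ereal" where
  "mismatch_coefficient p G =
     (SUP (\<pi>', \<pi>) \<in> stationary_policies G \<times> stationary_policies G. SUP s.
        ereal (pmf (stationary_distribution p \<pi>') s) / ereal (pmf (stationary_distribution p \<pi>) s))"

definition optimal_policy ::
  "('s::finite \<Rightarrow> 'a::finite \<Rightarrow> 's pmf) \<Rightarrow> ('s \<Rightarrow> 'a \<Rightarrow> 's \<Rightarrow> real) \<Rightarrow> ('s, 'a) policy \<Rightarrow> bool"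
where
  "optimal_policy p R \<pi> \<longleftrightarrow>
     \<pi> \<in> policies \<and> (\<forall>\<pi>'\<in>policies. average_reward p R \<pi>' \<le> average_reward p R \<pi>)"

definition seq_limit_point :: "(nat \<Rightarrow> 'b::topological_space) \<Rightarrow> 'b \<Rightarrow> bool" where
  "seq_limit_point X l \<longleftrightarrow> (\<exists>r. strict_mono r \<and> (X \<circ> r) \<longlonglongrightarrow> l)"

end

theory Submission
  imports Defs
begin

text \<open>
  For a kernel \<open>K\<close> and a reward \<open>r\<close>, the average reward is the constant \<open>g\<close> of the Poisson equation
  \<open>g + h = r + K h\<close>, which irreducibility makes solvable. Comparing two such equations at an extremal
  point of the difference of their solutions replaces every use of the stationary distribution.
  If the policy \<open>\<pi>'\<close> that is greedy for \<open>h\<close> improves on \<open>\<pi>\<close> by \<open>D \<ge> 0\<close>, \<open>D \<noteq> 0\<close>, in one step, then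
  the average reward has directional derivative at least \<open>c > 0\<close> along \<open>\<pi>' - \<pi>\<close>, where \<open>c\<close> is the
  average of \<open>D\<close> under \<open>K\<close>. So at a stationary point \<open>D = 0\<close>, which is Bellman's optimality equation.
  That limit points of projected gradient ascent are stationary is the usual descent argument.
\<close>

section \<open>Projected gradient ascent\<close>

lemma gderiv_along_line:
  assumes "GDERIV f (x + t *\<^sub>R d) :> g"
  shows "((\<lambda>t. f (x + t *\<^sub>R d)) has_real_derivative d \<bullet> g) (at t)"
proof -
  have "((\<lambda>t. x + t *\<^sub>R d) has_derivative (\<lambda>h. h *\<^sub>R d)) (at t)"
    by (auto intro!: derivative_eq_intros)
  from diff_chain_at[OF this assms[unfolded gderiv_def]] show ?thesis
    by (simp add: has_field_derivative_def o_def mult.commute[of _ "d \<bullet> g"])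
qed

text \<open>Along the segment from \<open>x\<close> to \<open>y\<close> the slope of
  \<open>f\<close> falls below its initial value by at most \<open>L * t * (norm d)\<^sup>2\<close>,
  by Cauchy-Schwarz and the Lipschitz bound. Integrating this over the segment gives the quadratic
  loss term.\<close>

lemma lipschitz_gradient_lower_bound:
  fixes G :: "'a::real_inner \<Rightarrow> 'a"
  assumes "convex S" and lip: "L-lipschitz_on S G"
    and deriv: "\<And>z. z \<in> S \<Longrightarrow> GDERIV f z :> G z"
    and "x \<in> S" "y \<in> S"
  shows "f x + (y - x) \<bullet> G x - L / 2 * (norm (y - x))\<^sup>2 \<le> f y"
proof -
  define d where "d = y - x"
  \<comment> \<open>The linear term removes the initial slope and the quadratic term compensates the
    largest possible drop of the slope, so \<open>\<phi>\<close> is nondecreasing;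
    \<open>\<phi> 0 \<le> \<phi> 1\<close> is the claim.\<close>
  define \<phi> where "\<phi> t = f (x + t *\<^sub>R d) - t * (d \<bullet> G x) + L / 2 * t\<^sup>2 * (norm d)\<^sup>2" for t
  have inS: "x + t *\<^sub>R d \<in> S" if "0 \<le> t" "t \<le> 1" for t
    using convexD_alt[OF \<open>convex S\<close> \<open>x \<in> S\<close> \<open>y \<in> S\<close> that]
    by (simp add: d_def algebra_simps)
  have "\<phi> 0 \<le> \<phi> 1"
  proof (rule DERIV_nonneg_imp_nondecreasing[of 0 1 \<phi>])
    fix t :: real
    assume t: "0 \<le> t" "t \<le> 1"
    let ?D = "d \<bullet> G (x + t *\<^sub>R d) - d \<bullet> G x + L * t * (norm d)\<^sup>2"
    have "(\<phi> has_real_derivative ?D) (at t)"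
      unfolding \<phi>_def
      by (rule derivative_eq_intros gderiv_along_line deriv inS t refl | simp)+
    moreover have "0 \<le> ?D"
    proof -
      have "norm (G (x + t *\<^sub>R d) - G x) \<le> L * (t * norm d)"
        using lipschitz_onD[OF lip inS[OF t] \<open>x \<in> S\<close>] t by (simp add: dist_norm)
      then have "norm d * norm (G (x + t *\<^sub>R d) - G x) \<le> norm d * (L * (t * norm d))"
        by (rule mult_left_mono) simp
      with Cauchy_Schwarz_ineq2[of d "G (x + t *\<^sub>R d) - G x"] show ?thesis
        by (simp add: inner_diff_right power2_eq_square algebra_simps)
    qed
    ultimately show "\<exists>y. (\<phi> has_real_derivative y) (at t) \<and> 0 \<le> y" by blast
  qed simp
  then show ?thesis by (simp add: \<phi>_def d_def)
qed

text \<open>The variational inequality of the projection, tested at the previous iterate, makes each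
  step raise \<open>f\<close> by a multiple of its squared length. Since \<open>f\<close> is bounded
  on \<open>S\<close>, the step lengths tend to 0, so the iterates \<open>x (r k)\<close> and their
  successors share the limit \<open>l\<close>. The same inequality, tested at \<open>y\<close>, then
  passes to the limit.\<close>

lemma projected_gradient_limit_point_stationary:
  fixes G :: "'a::euclidean_space \<Rightarrow> 'a"
  assumes "convex S" "compact S" and lip: "L-lipschitz_on S G"
    and deriv: "\<And>z. z \<in> S \<Longrightarrow> GDERIV f z :> G z"
    and "L > 0" "0 < \<alpha>" "\<alpha> \<le> 1 / L"
    and xS: "\<And>k. x k \<in> S"
    and step: "\<And>k. x (Suc k) = closest_point S (x k + \<alpha> *\<^sub>R G (x k))"
    and "strict_mono r" and lim: "(x \<circ> r) \<longlonglongrightarrow> l" and "y \<in> S"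
  shows "(y - l) \<bullet> G l \<le> 0"
proof -
  have "closed S" using \<open>compact S\<close> by (rule compact_imp_closed)
  have proj: "(x k + \<alpha> *\<^sub>R G (x k) - x (Suc k)) \<bullet> (z - x (Suc k)) \<le> 0" if "z \<in> S" for k z
    unfolding step[of k] by (rule closest_point_dot[OF \<open>convex S\<close> \<open>closed S\<close> that])
  have ascent: "L / 2 * (norm (x (Suc k) - x k))\<^sup>2 \<le> f (x (Suc k)) - f (x k)" for k
  proof -
    let ?d = "x (Suc k) - x k"
    have "(norm ?d)\<^sup>2 \<le> \<alpha> * (?d \<bullet> G (x k))"
      using proj[OF xS, of k k] unfolding power2_norm_eq_inner
      by (simp add: inner_diff_left inner_diff_right inner_add_left inner_commute algebra_simps)
    \<comment> \<open>Enlarging \<open>\<alpha>\<close> to \<open>1 / L\<close> requires a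
      nonnegative inner product, which the inequality just obtained supplies.\<close>
    also have "\<dots> \<le> 1 / L * (?d \<bullet> G (x k))"
    proof (rule mult_right_mono[OF \<open>\<alpha> \<le> 1 / L\<close>])
      have "0 \<le> \<alpha> * (?d \<bullet> G (x k))"
        using calculation zero_le_power2 order_trans by blast
      then show "0 \<le> ?d \<bullet> G (x k)" using \<open>0 < \<alpha>\<close> by (simp add: zero_le_mult_iff)
    qed
    \<comment> \<open>Half of this gain pays for the quadratic loss in
      \<open>lipschitz_gradient_lower_bound\<close>; the other half remains.\<close>
    finally have "L * (norm ?d)\<^sup>2 \<le> ?d \<bullet> G (x k)"
      using \<open>L > 0\<close> by (simp add: field_simps)
    with lipschitz_gradient_lower_bound[OF \<open>convex S\<close> lip deriv xS xS, of k "Suc k"]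
    show ?thesis by simp
  qed
  have "continuous_on S f"
    using deriv
    by (auto intro!: continuous_at_imp_continuous_on has_derivative_continuous simp: gderiv_def)
  then have "bounded (f ` S)"
    using \<open>compact S\<close> by (intro compact_imp_bounded compact_continuous_image)
  then have "bounded (range (\<lambda>k. f (x k)))" by (rule bounded_subset) (use xS in auto)
  then have "Bseq (\<lambda>k. f (x k))" by (simp add: Bseq_eq_bounded)
  moreover have "incseq (\<lambda>k. f (x k))"
  proof (rule incseq_SucI)
    fix k
    have "0 \<le> L / 2 * (norm (x (Suc k) - x k))\<^sup>2" using \<open>L > 0\<close> by simp
    with ascent[of k] show "f (x k) \<le> f (x (Suc k))" by linarith
  qed
  ultimately obtain F where F: "(\<lambda>k. f (x k)) \<longlonglongrightarrow> F"
    by (meson Bseq_monoseq_convergent convergentD incseq_imp_monoseq)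
  have "(\<lambda>k. f (x (Suc k)) - f (x k)) \<longlonglongrightarrow> 0"
    using tendsto_diff[OF LIMSEQ_Suc[OF F] F] by simp
  then have lim0: "(\<lambda>k. 2 / L * (f (x (Suc k)) - f (x k))) \<longlonglongrightarrow> 0"
    by (rule tendsto_mult_right_zero)
  have "norm ((norm (x (Suc k) - x k))\<^sup>2) \<le> 2 / L * (f (x (Suc k)) - f (x k))" for k
    using ascent[of k] \<open>L > 0\<close> by (simp add: field_simps)
  then have "(\<lambda>k. (norm (x (Suc k) - x k))\<^sup>2) \<longlonglongrightarrow> 0"
    by (intro Lim_null_comparison[OF always_eventually lim0] allI)
  from tendsto_real_sqrt[OF this] have "(\<lambda>k. x (Suc k) - x k) \<longlonglongrightarrow> 0"
    by (simp add: tendsto_norm_zero_iff)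
  from LIMSEQ_subseq_LIMSEQ[OF this \<open>strict_mono r\<close>]
  have diff: "(\<lambda>k. x (Suc (r k)) - x (r k)) \<longlonglongrightarrow> 0"
    by (simp add: o_def)
  have xl: "(\<lambda>k. x (r k)) \<longlonglongrightarrow> l" using lim by (simp add: o_def)
  have xSl: "(\<lambda>k. x (Suc (r k))) \<longlonglongrightarrow> l"
    using tendsto_add[OF diff xl] by simp
  have "l \<in> S" using closed_sequentially[OF \<open>closed S\<close> _ xl] xS by blast
  have Gl: "(\<lambda>k. G (x (r k))) \<longlonglongrightarrow> G l"
    by (rule continuous_on_tendsto_compose[OF lipschitz_on_continuous_on[OF lip] xl \<open>l \<in> S\<close>])
       (use xS in auto)
  have "(\<lambda>k. (x (r k) + \<alpha> *\<^sub>R G (x (r k)) - x (Suc (r k))) \<bullet> (y - x (Suc (r k))))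
      \<longlonglongrightarrow> (l + \<alpha> *\<^sub>R G l - l) \<bullet> (y - l)"
    by (intro tendsto_intros xl xSl Gl)
  then have "(l + \<alpha> *\<^sub>R G l - l) \<bullet> (y - l) \<le> 0"
    by (rule LIMSEQ_le_const2) (use proj[OF \<open>y \<in> S\<close>] in auto)
  then show ?thesis using \<open>0 < \<alpha>\<close> by (simp add: inner_commute mult_le_0_iff)
qed

section \<open>The Poisson equation of a finite kernel\<close>

definition stochastic_kernel :: "('s::finite \<Rightarrow> 's \<Rightarrow> real) \<Rightarrow> bool" where
  "stochastic_kernel K \<longleftrightarrow> (\<forall>s u. 0 \<le> K s u) \<and> (\<forall>s. (\<Sum>u\<in>UNIV. K s u) = 1)"

text \<open>\<open>g\<close> is the gain and \<open>h\<close> the bias (relative value function). A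
  relation is used because adding a constant to \<open>h\<close> yields another solution when the
  rows of \<open>K\<close> sum to 1.\<close>

definition poisson_solution ::
  "('s::finite \<Rightarrow> 's \<Rightarrow> real) \<Rightarrow> ('s \<Rightarrow> real) \<Rightarrow> real \<Rightarrow> ('s \<Rightarrow> real) \<Rightarrow> bool" where
  "poisson_solution K r g h \<longleftrightarrow> (\<forall>s. g + h s = r s + (\<Sum>u\<in>UNIV. K s u * h u))"

lemma stochastic_kernel_average_ge:
  assumes "stochastic_kernel K" and "\<And>u. m \<le> h u"
  shows "m \<le> (\<Sum>u\<in>UNIV. K s u * h u)"
proof -
  have "m = (\<Sum>u\<in>UNIV. K s u * m)"
    using assms(1) by (simp add: stochastic_kernel_def flip: sum_distrib_right)
  also have "\<dots> \<le> (\<Sum>u\<in>UNIV. K s u * h u)"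
    using assms by (intro sum_mono mult_left_mono) (auto simp: stochastic_kernel_def)
  finally show ?thesis .
qed

lemma stochastic_kernel_average_abs_le:
  assumes "stochastic_kernel K" and "\<And>u. \<bar>h u\<bar> \<le> B"
  shows "\<bar>\<Sum>u\<in>UNIV. K s u * h u\<bar> \<le> B"
proof -
  have "- B \<le> h u" "- B \<le> - h u" for u using assms(2)[of u] by auto
  then have "- B \<le> (\<Sum>u\<in>UNIV. K s u * h u)" and "- B \<le> (\<Sum>u\<in>UNIV. K s u * - h u)"
    by (intro stochastic_kernel_average_ge[OF assms(1)]; simp)+
  then show ?thesis by (simp add: abs_le_iff sum_negf)
qed

lemma stochastic_iterate_kernel:
  assumes "stochastic_kernel K"
  shows "stochastic_kernel (iterate_kernel K n)"
proof (induction n)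
  case 0
  then show ?case by (simp add: stochastic_kernel_def)
next
  case (Suc n)
  have "(\<Sum>v\<in>UNIV. \<Sum>u\<in>UNIV. K s u * iterate_kernel K n u v) = 1" for s
    using assms Suc by (subst sum.swap) (simp add: stochastic_kernel_def flip: sum_distrib_left)
  then show ?case
    using assms Suc by (auto simp: stochastic_kernel_def intro!: sum_nonneg)
qed

lemma ex_global_min:
  fixes h :: "'s::finite \<Rightarrow> real"
  obtains m where "\<And>u. h m \<le> h u"
proof -
  have "Min (range h) \<in> range h" by (intro Min_in) auto
  then obtain m where "h m = Min (range h)" by (metis imageE)
  then show ?thesis by (intro that[of m]) simp
qed

text \<open>Irreducibility speaks of iterates of \<open>K\<close>, so superharmonicity has to be
  carried over to them.\<close>

lemma superharmonic_iterate:
  assumes K: "stochastic_kernel K" and sup: "\<And>s. (\<Sum>u\<in>UNIV. K s u * h u) \<le> h s"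
  shows "(\<Sum>u\<in>UNIV. iterate_kernel K n s u * h u) \<le> h s"
proof (induction n arbitrary: s)
  case 0
  then show ?case by (simp add: if_distrib[of "\<lambda>c. c * _"] cong: if_cong)
next
  case (Suc n)
  have "(\<Sum>v\<in>UNIV. iterate_kernel K (Suc n) s v * h v)
      = (\<Sum>u\<in>UNIV. K s u * (\<Sum>v\<in>UNIV. iterate_kernel K n u v * h v))"
    by (simp add: sum_distrib_left sum_distrib_right mult.assoc) (rule sum.swap)
  also have "\<dots> \<le> (\<Sum>u\<in>UNIV. K s u * h u)"
    using K Suc by (intro sum_mono mult_left_mono) (auto simp: stochastic_kernel_def)
  finally show ?case using sup[of s] by linarith
qed

text \<open>Minimum principle: at a minimiser \<open>m\<close>, every iterate of \<open>K\<close>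
  averages the nonnegative function \<open>h - h m\<close> to at most 0, so \<open>h\<close> equals
  \<open>h m\<close> wherever the iterate puts positive weight. Irreducibility lets such weights
  reach every state.\<close>

lemma superharmonic_constant:
  fixes h :: "'s::finite \<Rightarrow> real"
  assumes K: "stochastic_kernel K" and irr: "irreducible_kernel K"
    and sup: "\<And>s. (\<Sum>u\<in>UNIV. K s u * h u) \<le> h s"
  obtains m where "\<And>u. h u = m"
proof -
  obtain m where m: "\<And>u. h m \<le> h u" using ex_global_min[of h] by blast
  have "h u = h m" for u
  proof -
    obtain n where pos: "0 < iterate_kernel K n m u"
      using irr by (auto simp: irreducible_kernel_def)
    let ?P = "iterate_kernel K n"
    have P: "stochastic_kernel ?P" by (rule stochastic_iterate_kernel[OF K])
    have "(\<Sum>v\<in>UNIV. ?P m v * (h v - h m)) \<le> 0"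
      using superharmonic_iterate[OF K sup, of n m] P
      by (simp add: right_diff_distrib sum_subtractf stochastic_kernel_def flip: sum_distrib_right)
    moreover have nonneg: "0 \<le> ?P m v * (h v - h m)" for v
      using P m[of v] by (simp add: stochastic_kernel_def)
    ultimately have "?P m u * (h u - h m) \<le> 0"
      using member_le_sum[of u UNIV "\<lambda>v. ?P m v * (h v - h m)"] by fastforce
    with pos m[of u] show ?thesis by (simp add: mult_le_0_iff)
  qed
  then show ?thesis by (rule that)
qed

text \<open>At a minimiser of \<open>h\<close> the average of \<open>h\<close> under
  \<open>K\<close> is at least \<open>h\<close> itself, so there \<open>g\<close> is at least
  \<open>r\<close>. This stands in for writing \<open>g\<close> as a stationary average of
  \<open>r\<close>.\<close>

lemma poisson_solution_ge:
  assumes "stochastic_kernel K" "poisson_solution K r g h" and "\<And>s. m \<le> r s"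
  shows "m \<le> g"
proof -
  obtain s where s: "\<And>u. h s \<le> h u" using ex_global_min[of h] by blast
  have "h s \<le> (\<Sum>u\<in>UNIV. K s u * h u)"
    by (rule stochastic_kernel_average_ge[OF assms(1) s])
  moreover have "g + h s = r s + (\<Sum>u\<in>UNIV. K s u * h u)"
    using assms(2) by (simp add: poisson_solution_def)
  ultimately show ?thesis using assms(3)[of s] by linarith
qed

lemma poisson_solution_diff:
  assumes "poisson_solution K r g h" "poisson_solution K r' g' h'"
  shows "poisson_solution K (\<lambda>s. r s - r' s) (g - g') (\<lambda>s. h s - h' s)"
  unfolding poisson_solution_def
proof
  fix s
  have "g + h s = r s + (\<Sum>u\<in>UNIV. K s u * h u)" "g' + h' s = r' s + (\<Sum>u\<in>UNIV. K s u * h' u)"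
    using assms by (auto simp: poisson_solution_def)
  then show "g - g' + (h s - h' s) = r s - r' s + (\<Sum>u\<in>UNIV. K s u * (h u - h' u))"
    by (simp add: right_diff_distrib sum_subtractf)
qed

text \<open>By linearity the difference of the two solutions has a nonnegative reward, so its gain
  is nonnegative. Used in both directions with equal rewards, this gives uniqueness of the
  gain.\<close>

lemma poisson_solution_mono:
  assumes "stochastic_kernel K" "poisson_solution K r g h" "poisson_solution K r' g' h'"
    and "\<And>s. r s \<le> r' s"
  shows "g \<le> g'"
  using poisson_solution_ge[OF assms(1) poisson_solution_diff[OF assms(3,2)], of 0] assms(4)
  by simp

text \<open>The normalisation \<open>h s\<^sub>0 = g\<close> turns the equation into a square linear system.\<close>

lemma poisson_solution_exists:
  fixes K :: "'s::finite \<Rightarrow> 's \<Rightarrow> real"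
  assumes K: "stochastic_kernel K" and irr: "irreducible_kernel K"
  obtains g h where "poisson_solution K r g h"
proof -
  obtain s0 :: 's where True by simp
  define M :: "real^'s \<Rightarrow> real^'s"
    where "M h = (\<chi> s. h $ s0 + h $ s - (\<Sum>u\<in>UNIV. K s u * h $ u))" for h
  have lin: "linear M"
    by (rule linearI)
       (simp_all add: M_def vec_eq_iff algebra_simps sum.distrib sum_distrib_left)
  have "inj M"
    unfolding linear_injective_0[OF lin]
  proof (intro allI impI)
    fix h
    assume "M h = 0"
    then have eq: "h $ s0 + h $ s = (\<Sum>u\<in>UNIV. K s u * h $ u)" for s
      by (simp add: M_def vec_eq_iff)
    \<comment> \<open>An element of the null space solves the equation with zero reward, so its gain
      \<open>h $ s0\<close> vanishes by uniqueness. Then \<open>h\<close> is harmonic, hence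
      constant, and the constant is \<open>h $ s0 = 0\<close>.\<close>
    then have p1: "poisson_solution K (\<lambda>_. 0) (h $ s0) (($) h)"
      by (simp add: poisson_solution_def)
    have p0: "poisson_solution K (\<lambda>_. 0) 0 (\<lambda>_. 0)" by (simp add: poisson_solution_def)
    have s0: "h $ s0 = 0"
      using poisson_solution_mono[OF K p1 p0] poisson_solution_mono[OF K p0 p1] by simp
    have "(\<Sum>u\<in>UNIV. K s u * h $ u) \<le> h $ s" for s using eq[of s] s0 by simp
    then obtain m where "\<And>u. h $ u = m"
      using superharmonic_constant[OF K irr, of "($) h"] by blast
    with s0 show "h = 0" by (simp add: vec_eq_iff)
  qed
  then have "surj M" by (rule linear_inj_imp_surj[OF lin])
  then obtain h where "M h = (\<chi> s. r s)" by (metis surjD)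
  then have "poisson_solution K r (h $ s0) (($) h)"
    by (simp add: poisson_solution_def M_def vec_eq_iff algebra_simps)
  then show ?thesis by (rule that)
qed

text \<open>With zero gain, \<open>h\<close> would be superharmonic, hence constant, and the
  equation would force \<open>r = 0\<close>. This replaces the argument that a stationary
  distribution charges every state.\<close>

lemma poisson_solution_pos:
  assumes K: "stochastic_kernel K" and irr: "irreducible_kernel K"
    and sol: "poisson_solution K r g h" and nonneg: "\<And>s. 0 \<le> r s" and "r s0 \<noteq> 0"
  shows "0 < g"
proof -
  have "0 \<le> g" by (rule poisson_solution_ge[OF K sol nonneg])
  moreover have "g \<noteq> 0"
  proof
    assume "g = 0"
    then have eq: "h s = r s + (\<Sum>u\<in>UNIV. K s u * h u)" for s
      using sol[unfolded poisson_solution_def, rule_format, of s] \<open>g = 0\<close> by simp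
    have "(\<Sum>u\<in>UNIV. K s u * h u) \<le> h s" for s using eq[of s] nonneg[of s] by linarith
    then obtain m where "\<And>u. h u = m"
      using superharmonic_constant[OF K irr, of h] by blast
    with eq[of s0] have "r s0 = 0"
      using K by (simp add: stochastic_kernel_def flip: sum_distrib_right)
    with \<open>r s0 \<noteq> 0\<close> show False by simp
  qed
  ultimately show ?thesis by simp
qed

section \<open>Average reward of a policy\<close>

text \<open>The continuation value \<open>v\<close> is left free: a bias function gives the relative
  Q-function, and the expected \<open>T\<close>-step reward gives the recursion for
  \<open>T + 1\<close> steps.\<close>

definition action_value ::
  "('s::finite \<Rightarrow> 'a::finite \<Rightarrow> 's pmf) \<Rightarrow> ('s \<Rightarrow> 'a \<Rightarrow> 's \<Rightarrow> real) \<Rightarrow> ('s \<Rightarrow> real) \<Rightarrow> 's \<Rightarrow> 'a \<Rightarrow> real"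
where
  "action_value p R v s a = (\<Sum>s'\<in>UNIV. pmf (p s a) s' * (R s a s' + v s'))"

definition policy_reward ::
  "('s::finite \<Rightarrow> 'a::finite \<Rightarrow> 's pmf) \<Rightarrow> ('s \<Rightarrow> 'a \<Rightarrow> 's \<Rightarrow> real) \<Rightarrow> ('s, 'a) policy \<Rightarrow> 's \<Rightarrow> real"
where
  "policy_reward p R \<pi> s = (\<Sum>a\<in>UNIV. \<pi> $ (s, a) * (\<Sum>s'\<in>UNIV. pmf (p s a) s' * R s a s'))"

text \<open>Links the Bellman operator, written action by action, to the kernel form of the Poisson
  equation.\<close>

lemma sum_action_value:
  "(\<Sum>a\<in>UNIV. \<pi> $ (s, a) * action_value p R v s a)
     = policy_reward p R \<pi> s + (\<Sum>u\<in>UNIV. kernel p \<pi> s u * v u)"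
proof -
  have "(\<Sum>u\<in>UNIV. kernel p \<pi> s u * v u)
      = (\<Sum>a\<in>UNIV. \<pi> $ (s, a) * (\<Sum>u\<in>UNIV. pmf (p s a) u * v u))"
    unfolding kernel_def sum_distrib_left sum_distrib_right mult.assoc by (rule sum.swap)
  then show ?thesis
    by (simp add: action_value_def policy_reward_def distrib_left sum.distrib)
qed

lemma sum_pmf_UNIV: "(\<Sum>x\<in>UNIV. pmf q (x::'b::finite)) = 1"
  by (rule sum_pmf_eq_1) auto

lemma stochastic_kernel_policy:
  assumes "\<pi> \<in> policies"
  shows "stochastic_kernel (kernel p \<pi>)"
proof -
  have "(\<Sum>u\<in>UNIV. kernel p \<pi> s u) = 1" for s
    using assms unfolding kernel_def
    by (subst sum.swap) (simp add: policies_def sum_pmf_UNIV flip: sum_distrib_left)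
  then show ?thesis
    using assms by (auto simp: stochastic_kernel_def policies_def kernel_def intro!: sum_nonneg)
qed

lemma pmf_action_pmf:
  assumes "\<pi> \<in> policies"
  shows "pmf (action_pmf \<pi> s) a = \<pi> $ (s, a)"
  unfolding action_pmf_def
proof (rule pmf_embed_pmf)
  show "0 \<le> \<pi> $ (s, x)" for x using assms by (simp add: policies_def)
  show "(\<integral>\<^sup>+ x. ennreal (\<pi> $ (s, x)) \<partial>count_space UNIV) = 1"
    using assms by (simp add: nn_integral_count_space_finite policies_def sum_ennreal)
qed

lemma finite_set_pmf_trajectory: "finite (set_pmf (trajectory p \<pi> T s))"
  by (induction T arbitrary: s) auto

text \<open>Condition on the first transition; finite supports turn the nested expectations into
  finite sums.\<close>

lemma expected_total_reward_Suc:
  assumes "\<pi> \<in> policies"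
  shows "expected_total_reward p R \<pi> (Suc T) s
    = (\<Sum>a\<in>UNIV. \<pi> $ (s, a) * action_value p R (expected_total_reward p R \<pi> T) s a)"
proof -
  let ?tot = "\<lambda>h. \<Sum>(u, a, u')\<leftarrow>h. R u a u'"
  have "measure_pmf.expectation (map_pmf ((#) (s, a, s')) (trajectory p \<pi> T s')) ?tot
      = R s a s' + expected_total_reward p R \<pi> T s'" for a s'
    using finite_set_pmf_trajectory[of p \<pi> T s']
    by (simp add: expected_total_reward_def Bochner_Integration.integral_add
        integrable_measure_pmf_finite)
  then show ?thesis
    by (simp add: expected_total_reward_def[of p R \<pi> "Suc T"] action_value_def
        pmf_expectation_bind[where A = UNIV] finite_set_pmf_trajectory pmf_action_pmf[OF assms])
qed

text \<open>The expected \<open>T\<close>-step reward stays within a fixed distance of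
  \<open>T * g + h s\<close>, so division by \<open>T\<close> leaves \<open>g\<close> in the limit,
  from every initial state.\<close>

lemma average_reward_eq_poisson:
  assumes \<pi>: "\<pi> \<in> policies"
    and sol: "poisson_solution (kernel p \<pi>) (policy_reward p R \<pi>) g h"
  shows "average_reward p R \<pi> = g"
proof -
  let ?V = "expected_total_reward p R \<pi>"
  have K: "stochastic_kernel (kernel p \<pi>)" by (rule stochastic_kernel_policy[OF \<pi>])
  define B where "B = (\<Sum>u\<in>UNIV. \<bar>h u\<bar>)"
  have hB: "\<bar>h u\<bar> \<le> B" for u
    unfolding B_def by (rule member_le_sum) auto
  \<comment> \<open>The error starts as \<open>- h s\<close>, and one more step replaces it by its
    average under the kernel, so the bound never grows.\<close>
  have err: "\<bar>?V T s - (real T * g + h s)\<bar> \<le> B" for T s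
  proof (induction T arbitrary: s)
    case 0
    then show ?case using hB by (simp add: expected_total_reward_def)
  next
    case (Suc T)
    have "?V (Suc T) s = policy_reward p R \<pi> s + (\<Sum>u\<in>UNIV. kernel p \<pi> s u * ?V T u)"
      by (simp add: expected_total_reward_Suc[OF \<pi>] sum_action_value)
    moreover have "g + h s = policy_reward p R \<pi> s + (\<Sum>u\<in>UNIV. kernel p \<pi> s u * h u)"
      using sol by (simp add: poisson_solution_def)
    moreover have "(\<Sum>u\<in>UNIV. kernel p \<pi> s u * (?V T u - (real T * g + h u)))
        = (\<Sum>u\<in>UNIV. kernel p \<pi> s u * ?V T u) - real T * g - (\<Sum>u\<in>UNIV. kernel p \<pi> s u * h u)"
      using K by (simp add: stochastic_kernel_def right_diff_distrib distrib_left sum_subtractf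
          sum.distrib flip: sum_distrib_right)
    ultimately have "?V (Suc T) s - (real (Suc T) * g + h s)
        = (\<Sum>u\<in>UNIV. kernel p \<pi> s u * (?V T u - (real T * g + h u)))"
      by (simp add: algebra_simps)
    then show ?case using stochastic_kernel_average_abs_le[OF K Suc] by simp
  qed
  have lim: "(\<lambda>T. ?V T s / real T) \<longlonglongrightarrow> g" for s
  proof -
    have "\<bar>?V T s - real T * g\<bar> \<le> 2 * B" for T
      using err[of T s] hB[of s] by linarith
    then have "\<bar>?V T s / real T - g\<bar> \<le> 2 * B / real T" if "T > 0" for T
      using that by (simp add: field_simps abs_le_iff)
    then have "\<forall>\<^sub>F T in sequentially. norm (?V T s / real T - g) \<le> 2 * B / real T"
      by (auto intro: eventually_mono[OF eventually_gt_at_top[of 0]])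
    moreover have "(\<lambda>T. 2 * B / real T) \<longlonglongrightarrow> 0" by (rule lim_const_over_n)
    ultimately have "(\<lambda>T. ?V T s / real T - g) \<longlonglongrightarrow> 0" by (rule Lim_null_comparison)
    then show ?thesis by (simp add: LIM_zero_iff)
  qed
  show ?thesis
    unfolding average_reward_def
    by (rule the_equality) (use lim LIMSEQ_unique in blast)+
qed

lemma average_reward_poisson:
  assumes "\<pi> \<in> policies" "ergodic_policy p \<pi>"
  obtains h where
    "poisson_solution (kernel p \<pi>) (policy_reward p R \<pi>) (average_reward p R \<pi>) h"
proof -
  have "irreducible_kernel (kernel p \<pi>)" using assms(2) by (simp add: ergodic_policy_def)
  then obtain g h where "poisson_solution (kernel p \<pi>) (policy_reward p R \<pi>) g h"
    using poisson_solution_exists stochastic_kernel_policy[OF assms(1)] by blast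
  with average_reward_eq_poisson[OF assms(1) this] show ?thesis
    by (intro that) simp
qed

section \<open>Stationary policies are optimal\<close>

lemma convex_policies: "convex policies"
proof (rule convexI)
  fix \<pi> \<sigma> :: "('a, 'b) policy" and u v :: real
  assume "\<pi> \<in> policies" "\<sigma> \<in> policies" "0 \<le> u" "0 \<le> v" "u + v = 1"
  then show "u *\<^sub>R \<pi> + v *\<^sub>R \<sigma> \<in> policies"
    by (simp add: policies_def sum.distrib flip: sum_distrib_left)
qed

lemma compact_policies: "compact (policies :: ('s::finite, 'a::finite) policy set)"
proof (rule compact_eq_bounded_closed[THEN iffD2], intro conjI)
  have "norm \<pi> \<le> (\<Sum>i\<in>(UNIV :: ('s \<times> 'a) set). 1)" if "\<pi> \<in> policies" for \<pi> :: "('s, 'a) policy"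
  proof (rule order_trans[OF norm_le_l1_cart sum_mono])
    fix i :: "'s \<times> 'a"
    obtain s a where i: "i = (s, a)" by (cases i)
    have "\<pi> $ (s, a) \<le> (\<Sum>b\<in>UNIV. \<pi> $ (s, b))"
      using that by (intro member_le_sum) (auto simp: policies_def)
    then show "\<bar>\<pi> $ i\<bar> \<le> 1" using that i by (simp add: policies_def)
  qed
  then show "bounded (policies :: ('s, 'a) policy set)" unfolding bounded_iff by blast
  have "policies = (\<Inter>s a. {\<pi> :: ('s, 'a) policy. 0 \<le> \<pi> $ (s, a)})
      \<inter> (\<Inter>s. {\<pi>. (\<Sum>a\<in>UNIV. \<pi> $ (s, a)) = 1})"
    by (auto simp: policies_def)
  also have "closed \<dots>"
    by (intro closed_Int closed_INT ballI closed_Collect_le closed_Collect_eq continuous_intros)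
  finally show "closed (policies :: ('s, 'a) policy set)" .
qed

text \<open>First-order perturbation: \<open>?g + t * c\<close> and \<open>h + t * w\<close> solve
  the Poisson equation of the mixed policy up to a residual of order \<open>t\<^sup>2\<close>.
  Comparison with its exact solution turns the residual into an error in the gain.\<close>

lemma average_reward_along_segment:
  assumes ergodic: "\<forall>\<pi>\<in>policies. ergodic_policy p \<pi>"
    and \<pi>: "\<pi> \<in> policies" "\<pi>' \<in> policies"
    and sol: "poisson_solution (kernel p \<pi>) (policy_reward p R \<pi>) (average_reward p R \<pi>) h"
    and adv: "\<And>s. D s = (\<Sum>a\<in>UNIV. \<pi>' $ (s, a) * action_value p R h s a)
                        - (average_reward p R \<pi> + h s)"
    and solD: "poisson_solution (kernel p \<pi>) D c w"
  obtains M where "\<And>t. 0 \<le> t \<Longrightarrow> t \<le> 1 \<Longrightarrow>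
    average_reward p R \<pi> + t * c - t\<^sup>2 * M \<le> average_reward p R (\<pi> + t *\<^sub>R (\<pi>' - \<pi>))"
proof -
  \<comment> \<open>\<open>E\<close> is the coefficient of \<open>t\<^sup>2\<close> left when the
    mixed kernel acts on \<open>h + t * w\<close>; \<open>M\<close> bounds it uniformly in the state
    and independently of \<open>t\<close>.\<close>
  define E where "E s = (\<Sum>u\<in>UNIV. kernel p \<pi>' s u * w u) - (\<Sum>u\<in>UNIV. kernel p \<pi> s u * w u)" for s
  define M where "M = (\<Sum>s\<in>UNIV. \<bar>E s\<bar>)"
  have EM: "\<bar>E s\<bar> \<le> M" for s
    unfolding M_def by (rule member_le_sum) auto
  have "average_reward p R \<pi> + t * c - t\<^sup>2 * M \<le> average_reward p R (\<pi> + t *\<^sub>R (\<pi>' - \<pi>))"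
    if t: "0 \<le> t" "t \<le> 1" for t
  proof -
    let ?g = "average_reward p R \<pi>"
    define \<sigma> where "\<sigma> = \<pi> + t *\<^sub>R (\<pi>' - \<pi>)"
    have \<sigma>: "\<sigma> \<in> policies"
      using convexD_alt[OF convex_policies \<pi> t] by (simp add: \<sigma>_def algebra_simps)
    obtain k where
      solt: "poisson_solution (kernel p \<sigma>) (policy_reward p R \<sigma>) (average_reward p R \<sigma>) k"
      using average_reward_poisson \<sigma> ergodic by metis
    have kern: "(\<Sum>u\<in>UNIV. kernel p \<sigma> s u * v u) = (1 - t) * (\<Sum>u\<in>UNIV. kernel p \<pi> s u * v u)
        + t * (\<Sum>u\<in>UNIV. kernel p \<pi>' s u * v u)" for s v
      by (simp add: kernel_def \<sigma>_def sum_distrib_left algebra_simps sum.distrib sum_subtractf)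
    have rew: "policy_reward p R \<sigma> s = (1 - t) * policy_reward p R \<pi> s
        + t * policy_reward p R \<pi>' s" for s
      by (simp add: policy_reward_def \<sigma>_def sum_distrib_left algebra_simps sum.distrib sum_subtractf)
    \<comment> \<open>The contributions \<open>t * D s\<close> cancel: one comes from mixing in
      \<open>\<pi>'\<close>, the other from the equation that \<open>w\<close> solves.\<close>
    have "poisson_solution (kernel p \<sigma>) (\<lambda>s. policy_reward p R \<sigma> s + t\<^sup>2 * - E s)
        (?g + t * c) (\<lambda>s. h s + t * w s)"
      unfolding poisson_solution_def
    proof
      fix s
      have 1: "?g + h s = policy_reward p R \<pi> s + (\<Sum>u\<in>UNIV. kernel p \<pi> s u * h u)"
        using sol by (simp add: poisson_solution_def)
      have 2: "c + w s = D s + (\<Sum>u\<in>UNIV. kernel p \<pi> s u * w u)"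
        using solD by (simp add: poisson_solution_def)
      have 3: "D s = policy_reward p R \<pi>' s + (\<Sum>u\<in>UNIV. kernel p \<pi>' s u * h u) - (?g + h s)"
        by (simp add: adv sum_action_value)
      have 4: "(\<Sum>u\<in>UNIV. kernel p \<sigma> s u * (h u + t * w u))
          = (\<Sum>u\<in>UNIV. kernel p \<sigma> s u * h u) + t * (\<Sum>u\<in>UNIV. kernel p \<sigma> s u * w u)"
        by (simp add: distrib_left sum.distrib sum_distrib_left mult.left_commute)
      show "?g + t * c + (h s + t * w s) = policy_reward p R \<sigma> s + t\<^sup>2 * - E s
          + (\<Sum>u\<in>UNIV. kernel p \<sigma> s u * (h u + t * w u))"
        using 1 2 3 unfolding 4 kern rew E_def by algebra
    qed
    from poisson_solution_diff[OF solt this]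
    have "poisson_solution (kernel p \<sigma>) (\<lambda>s. t\<^sup>2 * E s) (average_reward p R \<sigma> - (?g + t * c))
        (\<lambda>s. k s - (h s + t * w s))" by simp
    moreover have "- (t\<^sup>2 * M) \<le> t\<^sup>2 * E s" for s
      using EM[of s] mult_left_mono[of "- M" "E s" "t\<^sup>2"] by auto
    ultimately have "- (t\<^sup>2 * M) \<le> average_reward p R \<sigma> - (?g + t * c)"
      by (rule poisson_solution_ge[OF stochastic_kernel_policy[OF \<sigma>]])
    then show ?thesis by (simp add: \<sigma>_def)
  qed
  then show ?thesis by (rule that)
qed

text \<open>Divide the quadratic lower bound along the segment by \<open>t\<close> and let
  \<open>t\<close> decrease to 0. For \<open>t\<close> in [0,1] the segment consists of policies,
  where the extension \<open>f\<close> agrees with the average reward; the derivative of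
  \<open>f\<close> is therefore evaluated from the right.\<close>

lemma policy_gradient_ge:
  assumes ergodic: "\<forall>\<pi>\<in>policies. ergodic_policy p \<pi>"
    and gradient: "is_policy_gradient p R G"
    and \<pi>: "\<pi> \<in> policies" "\<pi>' \<in> policies"
    and sol: "poisson_solution (kernel p \<pi>) (policy_reward p R \<pi>) (average_reward p R \<pi>) h"
    and adv: "\<And>s. D s = (\<Sum>a\<in>UNIV. \<pi>' $ (s, a) * action_value p R h s a)
                        - (average_reward p R \<pi> + h s)"
    and solD: "poisson_solution (kernel p \<pi>) D c w"
  shows "c \<le> (\<pi>' - \<pi>) \<bullet> G \<pi>"
proof -
  obtain U f where f: "\<And>\<sigma>. \<sigma> \<in> policies \<Longrightarrow> f \<sigma> = average_reward p R \<sigma>"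
    and deriv: "GDERIV f \<pi> :> G \<pi>"
    using gradient \<pi>(1) unfolding is_policy_gradient_def by blast
  obtain M where M: "\<And>t. 0 \<le> t \<Longrightarrow> t \<le> 1 \<Longrightarrow>
      average_reward p R \<pi> + t * c - t\<^sup>2 * M \<le> average_reward p R (\<pi> + t *\<^sub>R (\<pi>' - \<pi>))"
    using average_reward_along_segment[OF ergodic \<pi> sol adv solD] by blast
  let ?q = "\<lambda>t. (f (\<pi> + t *\<^sub>R (\<pi>' - \<pi>)) - f \<pi>) / t"
  have "((\<lambda>t. f (\<pi> + t *\<^sub>R (\<pi>' - \<pi>))) has_real_derivative (\<pi>' - \<pi>) \<bullet> G \<pi>) (at 0)"
    by (rule gderiv_along_line) (simp add: deriv)
  then have "(?q \<longlongrightarrow> (\<pi>' - \<pi>) \<bullet> G \<pi>) (at_right 0)"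
    unfolding DERIV_def by (auto intro: tendsto_within_subset)
  moreover have "((\<lambda>t. c - t * M) \<longlongrightarrow> c - 0 * M) (at_right 0)"
    by (intro tendsto_intros)
  moreover have "\<forall>\<^sub>F t in at_right 0. c - t * M \<le> ?q t"
    using eventually_at_right_less[of "0::real"] eventually_at_right_real[of 0 "1::real", simplified]
  proof eventually_elim
    case (elim t)
    have "\<pi> + t *\<^sub>R (\<pi>' - \<pi>) \<in> policies"
      using convexD_alt[OF convex_policies \<pi>, of t] elim by (simp add: algebra_simps)
    then show ?case
      using M[of t] elim f \<pi>(1) by (simp add: field_simps power2_eq_square)
  qed
  ultimately have "c - 0 * M \<le> (\<pi>' - \<pi>) \<bullet> G \<pi>"
    by (intro tendsto_le[of "at_right (0::real)"]) auto
  then show ?thesis by simp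
qed

text \<open>Averaging the Bellman inequality over the actions of \<open>\<sigma>\<close> shows that
  the one-step reward of \<open>\<sigma>\<close> is dominated by the reward \<open>?r\<close> for
  which \<open>?g\<close> and \<open>h\<close> solve the equation of \<open>\<sigma>\<close>.
  Monotonicity of the gain concludes.\<close>

lemma optimal_policyI:
  assumes ergodic: "\<forall>\<pi>\<in>policies. ergodic_policy p \<pi>" and \<pi>: "\<pi> \<in> policies"
    and sol: "poisson_solution (kernel p \<pi>) (policy_reward p R \<pi>) (average_reward p R \<pi>) h"
    and bellman: "\<And>s a. action_value p R h s a \<le> average_reward p R \<pi> + h s"
  shows "optimal_policy p R \<pi>"
  unfolding optimal_policy_def
proof (intro conjI ballI \<pi>)
  fix \<sigma> :: "('a, 'b) policy"
  assume \<sigma>: "\<sigma> \<in> policies"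
  let ?g = "average_reward p R \<pi>"
  let ?r = "\<lambda>s. ?g + h s - (\<Sum>u\<in>UNIV. kernel p \<sigma> s u * h u)"
  obtain k where "poisson_solution (kernel p \<sigma>) (policy_reward p R \<sigma>) (average_reward p R \<sigma>) k"
    using average_reward_poisson \<sigma> ergodic by metis
  moreover have "poisson_solution (kernel p \<sigma>) ?r ?g h"
    by (simp add: poisson_solution_def)
  moreover have "policy_reward p R \<sigma> s \<le> ?r s" for s
  proof -
    have "(\<Sum>a\<in>UNIV. \<sigma> $ (s, a) * action_value p R h s a) \<le> (\<Sum>a\<in>UNIV. \<sigma> $ (s, a) * (?g + h s))"
      using \<sigma> bellman by (intro sum_mono mult_left_mono) (auto simp: policies_def)
    also have "\<dots> = ?g + h s" using \<sigma> by (simp add: policies_def flip: sum_distrib_right)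
    finally show ?thesis by (simp add: sum_action_value)
  qed
  ultimately show "average_reward p R \<sigma> \<le> ?g"
    by (rule poisson_solution_mono[OF stochastic_kernel_policy[OF \<sigma>]])
qed

lemma stationary_policy_optimal:
  fixes p :: "'s::finite \<Rightarrow> 'a::finite \<Rightarrow> 's pmf"
  assumes ergodic: "\<forall>\<pi>\<in>policies. ergodic_policy p \<pi>"
    and gradient: "is_policy_gradient p R G"
    and stat: "\<pi> \<in> stationary_policies G"
  shows "optimal_policy p R \<pi>"
proof -
  have \<pi>: "\<pi> \<in> policies" using stat by (simp add: stationary_policies_def)
  let ?g = "average_reward p R \<pi>"
  obtain h where
    sol: "poisson_solution (kernel p \<pi>) (policy_reward p R \<pi>) ?g h"
    using average_reward_poisson \<pi> ergodic by metis
  let ?q = "action_value p R h"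
  have "\<exists>b. \<forall>a. ?q s a \<le> ?q s b" for s
    using ex_global_min[of "\<lambda>a. - ?q s a"] by (metis neg_le_iff_le)
  then obtain b where b: "\<And>s a. ?q s a \<le> ?q s (b s)" by metis
  \<comment> \<open>The deterministic policy greedy for \<open>h\<close>; \<open>D\<close> is its
    one-step advantage over \<open>\<pi>\<close>.\<close>
  define \<pi>' :: "('s, 'a) policy" where "\<pi>' = (\<chi> i. if snd i = b (fst i) then 1 else 0)"
  have \<pi>': "\<pi>' \<in> policies" by (simp add: policies_def \<pi>'_def)
  define D where "D s = ?q s (b s) - (?g + h s)" for s
  have adv: "D s = (\<Sum>a\<in>UNIV. \<pi>' $ (s, a) * ?q s a) - (?g + h s)" for s
    by (simp add: D_def \<pi>'_def if_distrib[of "\<lambda>c. c * _"] cong: if_cong)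
  have D_nonneg: "0 \<le> D s" for s
  proof -
    have "?g + h s = (\<Sum>a\<in>UNIV. \<pi> $ (s, a) * ?q s a)"
      using sol by (simp add: sum_action_value poisson_solution_def)
    also have "\<dots> \<le> (\<Sum>a\<in>UNIV. \<pi> $ (s, a) * ?q s (b s))"
      using \<pi> b by (intro sum_mono mult_left_mono) (auto simp: policies_def)
    also have "\<dots> = ?q s (b s)" using \<pi> by (simp add: policies_def flip: sum_distrib_right)
    finally show ?thesis by (simp add: D_def)
  qed
  have K: "stochastic_kernel (kernel p \<pi>)" by (rule stochastic_kernel_policy[OF \<pi>])
  have irr: "irreducible_kernel (kernel p \<pi>)"
    using ergodic \<pi> by (simp add: ergodic_policy_def)
  obtain c w where solD: "poisson_solution (kernel p \<pi>) D c w"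
    by (rule poisson_solution_exists[OF K irr])
  have "c \<le> (\<pi>' - \<pi>) \<bullet> G \<pi>"
    by (rule policy_gradient_ge[OF ergodic gradient \<pi> \<pi>' sol adv solD])
  also have "\<dots> \<le> 0" using stat \<pi>' by (simp add: stationary_policies_def)
  \<comment> \<open>A nonzero value of \<open>D\<close> would make its gain \<open>c\<close>
    strictly positive, against \<open>c \<le> 0\<close>.\<close>
  finally have "D s = 0" for s
    using poisson_solution_pos[OF K irr solD D_nonneg] by fastforce
  then have "?q s a \<le> ?g + h s" for s a
    using b[of s a] by (simp add: D_def)
  then show ?thesis by (rule optimal_policyI[OF ergodic \<pi> sol])
qed

theorem theorem4p6:
  fixes p :: "'s::finite \<Rightarrow> 'a::finite \<Rightarrow> 's pmf"
    and R :: "'s \<Rightarrow> 'a \<Rightarrow> 's \<Rightarrow> real"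
    and G :: "('s, 'a) policy \<Rightarrow> ('s, 'a) policy"
    and x :: "nat \<Rightarrow> ('s, 'a) policy"
    and c :: ereal
    and L \<alpha> :: real
  assumes ergodic: "\<forall>\<pi>\<in>policies. ergodic_policy p \<pi>"
    and gradient: "is_policy_gradient p R G"
    and c_def: "c = mismatch_coefficient p G"
    and c_finite: "\<bar>c\<bar> \<noteq> \<infinity>"
    and L_pos: "L > 0"
    and lipschitz: "L-lipschitz_on policies G"
    and stepsize: "\<alpha> \<in> {0<..1 / L}"
    and init: "x 0 \<in> policies"
    and step: "\<forall>k. x (Suc k) = closest_point policies (x k + \<alpha> *\<^sub>R G (x k))"
  shows "(\<exists>\<pi>. seq_limit_point x \<pi>) \<and> (\<forall>\<pi>. seq_limit_point x \<pi> \<longrightarrow> optimal_policy p R \<pi>)"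
proof -
  \<comment> \<open>The projection is known to land in \<open>policies\<close> only when this set is
    nonempty; the initial policy witnesses that.\<close>
  have nonempty: "policies \<noteq> ({} :: ('s, 'a) policy set)" using init by blast
  have xS: "x k \<in> policies" for k
  proof (cases k)
    case (Suc n)
    then show ?thesis
      using step closest_point_in_set[OF compact_imp_closed[OF compact_policies] nonempty] by simp
  qed (use init in simp)
  obtain f where deriv: "\<And>\<pi>. \<pi> \<in> policies \<Longrightarrow> GDERIV f \<pi> :> G \<pi>"
    using gradient unfolding is_policy_gradient_def by blast
  have "optimal_policy p R \<pi>" if lp: "seq_limit_point x \<pi>" for \<pi>
  proof -
    obtain r where r: "strict_mono r" "(x \<circ> r) \<longlonglongrightarrow> \<pi>"
      using lp unfolding seq_limit_point_def by blast
    have "\<pi> \<in> policies"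
      by (rule closed_sequentially[OF compact_imp_closed[OF compact_policies] _ r(2)])
         (simp add: xS)
    moreover have "(\<pi>' - \<pi>) \<bullet> G \<pi> \<le> 0" if "\<pi>' \<in> policies" for \<pi>'
      by (rule projected_gradient_limit_point_stationary[OF convex_policies compact_policies
            lipschitz deriv L_pos _ _ xS _ r that])
         (use stepsize step in auto)
    ultimately show ?thesis
      by (intro stationary_policy_optimal[OF ergodic gradient]) (simp add: stationary_policies_def)
  qed
  moreover have "\<exists>\<pi>. seq_limit_point x \<pi>"
    using compact_policies xS unfolding compact_def seq_limit_point_def by metis
  ultimately show ?thesis by blast
qed

end
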